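(* Let $n_1,n_2>0$. For every $\hat p\in[-1,1]$ and $z>0$, let $L=\min_{(q_1,q_2)\in\Omega_\square}(q_1-q_2)$ and $U=\max_{(q_1,q_2)\in\Omega_\square}(q_1-q_2)$ be the optimal values over the set $\Omega_\square=\Omega_\square(\hat p;n_1,n_2,z)$ defined in the context. Then $(L,U)$ is given by the following six cases: (1) $(L,U)=(L_1,U_1)$ if $\hat p_\square<\hat p\le 1$ and $0<z\le R_1$; (2) $(L,U)=(L_2,U_1)$ if $-1\le\hat p\le 1$ and $z\ge R_2$; (3) $(L,U)=(L_2,U_2)$ if $-1\le\hat p<-\hat p_\square$ and $0<z\le R_1$; (4) $(L,U)=(L_2,U_3)$ if either [$-1\le\hat p\le-\hat p_\square$ and $R_1<z<R_2$] or [$-\hat p_\square<\hat p<0$ and $R_1\le z<R_2$]; (5) $(L,U)=(L_3,U_1)$ if either [$0<\hat p<\hat p_\square$ and $R_1\le z<R_2$] or [$\hat p_\square\le\hat p\le1$ and $R_1<z<R_2$]; (6) $(L,U)=(L_3,U_3)$ if $-\hat p_\square<\hat p<\hat p_\square$ and $0<z<R_1$. Moreover, the six condition sets are pairwise disjoint and exhaust the domain $\{(\hat p,z):\hat p\in[-1,1],\ z>0\}$ (so the interval $[L,U]$ is uniquely determined by the data), and every bound $L_i$, $U_j$ appearing in a case is real (i.e. its radicand is non-negative) throughout the region in which it is invoked.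
   Context: Write $n_{\min}=\min(n_1,n_2)$, $n_{\max}=\max(n_1,n_2)$, and $\hat p_\square=\dfrac{n_{\max}+n_{\min}}{2n_{\max}}$. Feasible set. Let $V(p_1,p_2)=\frac{p_1(1-p_1)}{n_1}+\frac{p_2(1-p_2)}{n_2}$ and $$\Omega_\square=\{(p_1,p_2)\in[0,1]^2:(\hat p-p_1+p_2)^2\le z^2V(p_1,p_2)\}.$$ Bounds. Define $$L_1,U_1=\frac{n_{\min}\hat p+z^2/2}{n_{\min}+z^2}\mp\frac{z\sqrt{z^2+4n_{\min}\hat p(1-\hat p)}}{2(n_{\min}+z^2)},$$ $$L_2,U_2=\frac{n_{\min}\hat p-z^2/2}{n_{\min}+z^2}\mp\frac{z\sqrt{z^2-4n_{\min}\hat p(1+\hat p)}}{2(n_{\min}+z^2)},$$ $$L_3,U_3=\frac{(n_{\max}+n_{\min})\hat p}{n_{\max}+n_{\min}+z^2}\mp\frac{z}{2(n_{\max}+n_{\min}+z^2)}\sqrt{\frac{(n_{\max}+n_{\min})\,\Xi}{n_{\max}n_{\min}}},$$ where $\Xi=(n_{\max}+n_{\min})(n_{\max}+n_{\min}+z^2)-4n_{\max}n_{\min}\hat p^2$; in each pair the minus sign gives $L_i$ and the plus sign gives $U_i$. Thresholds (functions of $\hat p,n_1,n_2$). Define $$R_1=\frac{\sqrt{n_{\min}}\,\bigl|2n_{\max}|\hat p|-(n_{\max}+n_{\min})\bigr|}{\sqrt{n_{\max}^2-n_{\min}^2}},\qquad R_2=\frac{\sqrt{n_{\min}}\,\bigl(2n_{\max}|\hat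 p|+(n_{\max}+n_{\min})\bigr)}{\sqrt{n_{\max}^2-n_{\min}^2}},$$ with the conventions $c/0=+\infty$ for $c>0$ and $0/0=0$. Thus if $n_1=n_2$, then $R_2=\infty$, $R_1=\infty$ for $|\hat p|<1$, and $R_1=0$ for $|\hat p|=1$. *)

theory Defs
  imports "HOL-Analysis.Analysis" "HOL-Library.Disjoint_Sets" "HOL-Library.Extended_Real"
begin

definition n_min :: "real \<Rightarrow> real \<Rightarrow> real" where
  "n_min n1 n2 = min n1 n2"

definition n_max :: "real \<Rightarrow> real \<Rightarrow> real" where
  "n_max n1 n2 = max n1 n2"

definition p_square :: "real \<Rightarrow> real \<Rightarrow> real" where
  "p_square n1 n2 = (n_max n1 n2 + n_min n1 n2) / (2 * n_max n1 n2)"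

definition V :: "real \<Rightarrow> real \<Rightarrow> real \<Rightarrow> real \<Rightarrow> real" where
  "V n1 n2 p1 p2 = p1 * (1 - p1) / n1 + p2 * (1 - p2) / n2"

definition Omega_square :: "real \<Rightarrow> real \<Rightarrow> real \<Rightarrow> real \<Rightarrow> (real \<times> real) set" where
  "Omega_square n1 n2 ph z =
     {(p1, p2). p1 \<in> {0..1} \<and> p2 \<in> {0..1} \<and> (ph - p1 + p2)\<^sup>2 \<le> z\<^sup>2 * V n1 n2 p1 p2}"

definition minimum_value :: "('a \<Rightarrow> real) \<Rightarrow> 'a set \<Rightarrow> real \<Rightarrow> bool" where
  "minimum_value f S m \<longleftrightarrow> (\<exists>x\<in>S. f x = m) \<and> (\<forall>x\<in>S. m \<le> f x)"

definition maximum_value :: "('a \<Rightarrow> real) \<Rightarrow> 'a set \<Rightarrow> real \<Rightarrow> bool" where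
  "maximum_value f S m \<longleftrightarrow> (\<exists>x\<in>S. f x = m) \<and> (\<forall>x\<in>S. f x \<le> m)"

definition optimal_values :: "real \<Rightarrow> real \<Rightarrow> real \<Rightarrow> real \<Rightarrow> real \<times> real \<Rightarrow> bool" where
  "optimal_values n1 n2 ph z = (\<lambda>(L, U).
     minimum_value (\<lambda>(q1, q2). q1 - q2) (Omega_square n1 n2 ph z) L \<and>
     maximum_value (\<lambda>(q1, q2). q1 - q2) (Omega_square n1 n2 ph z) U)"

(* sqrt is total on the reals, with sqrt (- x) = - sqrt x, so the radicands of the bounds
   are named in order to state separately that they are non-negative. *)

definition rad1 :: "real \<Rightarrow> real \<Rightarrow> real \<Rightarrow> real \<Rightarrow> real" where
  "rad1 n1 n2 ph z = z\<^sup>2 + 4 * n_min n1 n2 * ph * (1 - ph)"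

definition rad2 :: "real \<Rightarrow> real \<Rightarrow> real \<Rightarrow> real \<Rightarrow> real" where
  "rad2 n1 n2 ph z = z\<^sup>2 - 4 * n_min n1 n2 * ph * (1 + ph)"

definition Xi :: "real \<Rightarrow> real \<Rightarrow> real \<Rightarrow> real \<Rightarrow> real" where
  "Xi n1 n2 ph z = (n_max n1 n2 + n_min n1 n2) * (n_max n1 n2 + n_min n1 n2 + z\<^sup>2)
     - 4 * n_max n1 n2 * n_min n1 n2 * ph\<^sup>2"

definition rad3 :: "real \<Rightarrow> real \<Rightarrow> real \<Rightarrow> real \<Rightarrow> real" where
  "rad3 n1 n2 ph z =
     (n_max n1 n2 + n_min n1 n2) * Xi n1 n2 ph z / (n_max n1 n2 * n_min n1 n2)"

definition L1 :: "real \<Rightarrow> real \<Rightarrow> real \<Rightarrow> real \<Rightarrow> real" where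
  "L1 n1 n2 ph z = (n_min n1 n2 * ph + z\<^sup>2 / 2) / (n_min n1 n2 + z\<^sup>2)
     - z * sqrt (rad1 n1 n2 ph z) / (2 * (n_min n1 n2 + z\<^sup>2))"

definition U1 :: "real \<Rightarrow> real \<Rightarrow> real \<Rightarrow> real \<Rightarrow> real" where
  "U1 n1 n2 ph z = (n_min n1 n2 * ph + z\<^sup>2 / 2) / (n_min n1 n2 + z\<^sup>2)
     + z * sqrt (rad1 n1 n2 ph z) / (2 * (n_min n1 n2 + z\<^sup>2))"

definition L2 :: "real \<Rightarrow> real \<Rightarrow> real \<Rightarrow> real \<Rightarrow> real" where
  "L2 n1 n2 ph z = (n_min n1 n2 * ph - z\<^sup>2 / 2) / (n_min n1 n2 + z\<^sup>2)
     - z * sqrt (rad2 n1 n2 ph z) / (2 * (n_min n1 n2 + z\<^sup>2))"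

definition U2 :: "real \<Rightarrow> real \<Rightarrow> real \<Rightarrow> real \<Rightarrow> real" where
  "U2 n1 n2 ph z = (n_min n1 n2 * ph - z\<^sup>2 / 2) / (n_min n1 n2 + z\<^sup>2)
     + z * sqrt (rad2 n1 n2 ph z) / (2 * (n_min n1 n2 + z\<^sup>2))"

definition L3 :: "real \<Rightarrow> real \<Rightarrow> real \<Rightarrow> real \<Rightarrow> real" where
  "L3 n1 n2 ph z =
     (n_max n1 n2 + n_min n1 n2) * ph / (n_max n1 n2 + n_min n1 n2 + z\<^sup>2)
     - z / (2 * (n_max n1 n2 + n_min n1 n2 + z\<^sup>2)) * sqrt (rad3 n1 n2 ph z)"

definition U3 :: "real \<Rightarrow> real \<Rightarrow> real \<Rightarrow> real \<Rightarrow> real" where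
  "U3 n1 n2 ph z =
     (n_max n1 n2 + n_min n1 n2) * ph / (n_max n1 n2 + n_min n1 n2 + z\<^sup>2)
     + z / (2 * (n_max n1 n2 + n_min n1 n2 + z\<^sup>2)) * sqrt (rad3 n1 n2 ph z)"

(* Division on ereal is x / y = x * inverse y with inverse 0 = \<infinity>, hence
   c / 0 = \<infinity> for c > 0 and 0 / 0 = 0: exactly the conventions needed for n1 = n2. *)

definition R1 :: "real \<Rightarrow> real \<Rightarrow> real \<Rightarrow> ereal" where
  "R1 n1 n2 ph =
     ereal (sqrt (n_min n1 n2) * \<bar>2 * n_max n1 n2 * \<bar>ph\<bar> - (n_max n1 n2 + n_min n1 n2)\<bar>)
     / ereal (sqrt ((n_max n1 n2)\<^sup>2 - (n_min n1 n2)\<^sup>2))"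

definition R2 :: "real \<Rightarrow> real \<Rightarrow> real \<Rightarrow> ereal" where
  "R2 n1 n2 ph =
     ereal (sqrt (n_min n1 n2) * (2 * n_max n1 n2 * \<bar>ph\<bar> + (n_max n1 n2 + n_min n1 n2)))
     / ereal (sqrt ((n_max n1 n2)\<^sup>2 - (n_min n1 n2)\<^sup>2))"

datatype bound_case = Case1 | Case2 | Case3 | Case4 | Case5 | Case6

fun region :: "real \<Rightarrow> real \<Rightarrow> bound_case \<Rightarrow> (real \<times> real) set" where
  "region n1 n2 Case1 =
     {(ph, z). p_square n1 n2 < ph \<and> ph \<le> 1 \<and> 0 < z \<and> ereal z \<le> R1 n1 n2 ph}"
| "region n1 n2 Case2 =
     {(ph, z). - 1 \<le> ph \<and> ph \<le> 1 \<and> R2 n1 n2 ph \<le> ereal z}"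
| "region n1 n2 Case3 =
     {(ph, z). - 1 \<le> ph \<and> ph < - p_square n1 n2 \<and> 0 < z \<and> ereal z \<le> R1 n1 n2 ph}"
| "region n1 n2 Case4 =
     {(ph, z). (- 1 \<le> ph \<and> ph \<le> - p_square n1 n2 \<and> R1 n1 n2 ph < ereal z \<and> ereal z < R2 n1 n2 ph)
             \<or> (- p_square n1 n2 < ph \<and> ph < 0 \<and> R1 n1 n2 ph \<le> ereal z \<and> ereal z < R2 n1 n2 ph)}"
| "region n1 n2 Case5 =
     {(ph, z). (0 < ph \<and> ph < p_square n1 n2 \<and> R1 n1 n2 ph \<le> ereal z \<and> ereal z < R2 n1 n2 ph)
             \<or> (p_square n1 n2 \<le> ph \<and> ph \<le> 1 \<and> R1 n1 n2 ph < ereal z \<and> ereal z < R2 n1 n2 ph)}"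
| "region n1 n2 Case6 =
     {(ph, z). - p_square n1 n2 < ph \<and> ph < p_square n1 n2 \<and> 0 < z \<and> ereal z < R1 n1 n2 ph}"

end

theory Submission
  imports Defs
begin

text \<open>
  The objective depends on \<open>(p1, p2)\<close> only through \<open>d = p1 - p2\<close>, and so does the left-hand
  side of the constraint. A difference \<open>d\<close> is therefore attained in the feasible set exactly
  when \<open>(ph - d)\<^sup>2 \<le> z\<^sup>2 g(d)\<close>, where \<open>g(d)\<close> is the largest value of the variance on the
  segment \<open>p1 - p2 = d\<close> of the unit square. On that segment \<open>V\<close> is a concave parabola. Write
  \<open>m \<le> M\<close> for the two sample sizes and \<open>p\<close> for \<open>p_square\<close>. If \<open>\<bar>d\<bar> \<le> p\<close>, the vertex lies on
  the segment and \<open>g(d) = (1/M + 1/m)/4 - d\<^sup>2/(M + m)\<close>. If \<open>d \<ge> p\<close>, the maximum sits at an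
  end of the segment and \<open>g(d) = d (1 - d)/m\<close>; if \<open>d \<le> - p\<close>, it is \<open>- d (1 + d)/m\<close>. So the
  set of attained differences is cut out by three quadratic inequalities, one for each range
  of \<open>d\<close>, and \<open>L1, U1\<close>, \<open>L2, U2\<close>, \<open>L3, U3\<close> are the roots of the quadratics of the upper,
  lower and middle range (\<open>edge_gap_nonpos_iff\<close> and \<open>interior_gap_nonpos_iff\<close>).

  Which root is the optimum depends only on the range that contains it. The edge quadratic
  lies above the interior one and touches it at \<open>p\<close>, so the two have the same sign there,
  and this sign tells on which side of \<open>p\<close> an extreme difference falls: the maximum is \<open>U1\<close>
  if \<open>ph\<close> or \<open>p\<close> itself witnesses an attained difference beyond \<open>p\<close> (\<open>greatest_U1\<close>), it is
  \<open>U3\<close> if neither does but \<open>ph\<close> or \<open>- p\<close> witnesses an attained difference in the middle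
  range (\<open>greatest_U3\<close>), and the minimum is \<open>L1\<close> if \<open>ph > p\<close> and no difference below \<open>p\<close> is
  attained (\<open>smallest_L1\<close>). The remaining three bounds follow from the reflection \<open>(p1, p2)
  \<mapsto> (1 - p1, 1 - p2)\<close>, which negates both \<open>d\<close> and \<open>ph\<close>.

  Finally the sign of the quadratic at the near and at the far one of \<open>\<plusminus>p\<close> is decided by
  comparing \<open>z\<close> with \<open>R1\<close> and with \<open>R2\<close>. This turns the reachability conditions into the six
  regions. A radicand is non-negative wherever its bound is used, because the corresponding
  quadratic takes a non-positive value there.
\<close>

section \<open>The constraint as a condition on the difference\<close>

text \<open>The excess of the left-hand over the right-hand side of the constraint when \<open>V\<close> is
  replaced by its maximum over the whole line \<open>p1 - p2 = d\<close>, ignoring the unit square.\<close>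
definition interior_gap :: "real \<Rightarrow> real \<Rightarrow> real \<Rightarrow> real \<Rightarrow> real \<Rightarrow> real" where
  "interior_gap n1 n2 ph z d =
     (ph - d)\<^sup>2 - z\<^sup>2 * ((1 / n_max n1 n2 + 1 / n_min n1 n2) / 4 - d\<^sup>2 / (n_max n1 n2 + n_min n1 n2))"

text \<open>For \<open>d \<in> {0..1}\<close>, the excess of the left-hand over the right-hand side of the
  constraint at the point of the unit square with difference \<open>d\<close> at which the proportion of
  the larger sample is 0 or 1, so that the smaller sample contributes the whole variance.
  The opposite edge, relevant for \<open>d < 0\<close>, is covered by negating \<open>ph\<close> and \<open>d\<close>.\<close>
definition edge_gap :: "real \<Rightarrow> real \<Rightarrow> real \<Rightarrow> real \<Rightarrow> real \<Rightarrow> real" where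
  "edge_gap n1 n2 ph z d = (ph - d)\<^sup>2 - z\<^sup>2 * (d * (1 - d) / n_min n1 n2)"

definition differences :: "real \<Rightarrow> real \<Rightarrow> real \<Rightarrow> real \<Rightarrow> real set" where
  "differences n1 n2 ph z = (\<lambda>(p1, p2). p1 - p2) ` Omega_square n1 n2 ph z"

lemma n_min_pos: "n1 > 0 \<Longrightarrow> n2 > 0 \<Longrightarrow> 0 < n_min n1 n2"
  and n_max_pos: "n1 > 0 \<Longrightarrow> n2 > 0 \<Longrightarrow> 0 < n_max n1 n2"
  and n_min_le_n_max: "n_min n1 n2 \<le> n_max n1 n2"
  by (auto simp: n_min_def n_max_def)

lemma n_min_commute: "n_min n2 n1 = n_min n1 n2"
  and n_max_commute: "n_max n2 n1 = n_max n1 n2"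
  by (auto simp: n_min_def n_max_def)

lemma p_square_pos: "n1 > 0 \<Longrightarrow> n2 > 0 \<Longrightarrow> 0 < p_square n1 n2"
  using n_min_pos[of n1 n2] n_max_pos[of n1 n2] by (simp add: p_square_def)

lemma p_square_le_1: "n1 > 0 \<Longrightarrow> n2 > 0 \<Longrightarrow> p_square n1 n2 \<le> 1"
  using n_max_pos[of n1 n2] n_min_le_n_max[of n1 n2] by (simp add: p_square_def)

section \<open>Symmetries\<close>

lemma mem_differences_iff:
  "d \<in> differences n1 n2 ph z \<longleftrightarrow>
     (\<exists>q. q \<in> {0..1} \<and> d + q \<in> {0..1} \<and> (ph - d)\<^sup>2 \<le> z\<^sup>2 * V n1 n2 (d + q) q)"
proof
  assume "d \<in> differences n1 n2 ph z"
  then obtain p q where "d = p - q" "p \<in> {0..1}" "q \<in> {0..1}"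
      "(ph - p + q)\<^sup>2 \<le> z\<^sup>2 * V n1 n2 p q"
    by (auto simp: differences_def Omega_square_def)
  moreover from \<open>d = p - q\<close> have "ph - p + q = ph - d" "d + q = p" by simp_all
  ultimately show "\<exists>q. q \<in> {0..1} \<and> d + q \<in> {0..1} \<and> (ph - d)\<^sup>2 \<le> z\<^sup>2 * V n1 n2 (d + q) q"
    by (intro exI[of _ q]) simp
next
  assume "\<exists>q. q \<in> {0..1} \<and> d + q \<in> {0..1} \<and> (ph - d)\<^sup>2 \<le> z\<^sup>2 * V n1 n2 (d + q) q"
  then obtain q where q: "q \<in> {0..1}" "d + q \<in> {0..1}" "(ph - d)\<^sup>2 \<le> z\<^sup>2 * V n1 n2 (d + q) q"
    by blast
  have "(d + q, q) \<in> Omega_square n1 n2 ph z"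
    using q by (simp add: Omega_square_def)
  then show "d \<in> differences n1 n2 ph z"
    unfolding differences_def by (rule image_eqI[rotated]) simp
qed

text \<open>The map \<open>(p1, p2) \<mapsto> (1 - p2, 1 - p1)\<close> keeps the difference and exchanges the roles of
  the two samples. It allows the assumption \<open>n1 \<le> n2\<close> whenever an end of a segment is
  considered.\<close>
lemma differences_commute: "differences n1 n2 ph z = differences n2 n1 ph z"
proof -
  have "d \<in> differences n2 n1 ph z" if "d \<in> differences n1 n2 ph z" for d n1 n2
  proof -
    from that obtain q where q: "q \<in> {0..1}" "d + q \<in> {0..1}"
      "(ph - d)\<^sup>2 \<le> z\<^sup>2 * V n1 n2 (d + q) q"
      by (auto simp: mem_differences_iff)
    have "V n2 n1 (d + (1 - d - q)) (1 - d - q) = V n1 n2 (d + q) q"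
      by (simp add: V_def algebra_simps)
    with q show ?thesis
      unfolding mem_differences_iff by (intro exI[of _ "1 - d - q"]) auto
  qed
  then show ?thesis by blast
qed

text \<open>The map \<open>(p1, p2) \<mapsto> (1 - p1, 1 - p2)\<close> keeps the variance and negates the difference.
  This symmetry halves the work: facts about the maximum become facts about the minimum.\<close>
lemma differences_reflect:
  "d \<in> differences n1 n2 (- ph) z \<longleftrightarrow> - d \<in> differences n1 n2 ph z"
proof -
  have "- d \<in> differences n1 n2 (- ph) z" if "d \<in> differences n1 n2 ph z" for d ph
  proof -
    from that obtain q where q: "q \<in> {0..1}" "d + q \<in> {0..1}"
      "(ph - d)\<^sup>2 \<le> z\<^sup>2 * V n1 n2 (d + q) q"
      by (auto simp: mem_differences_iff)
    have "V n1 n2 (- d + (1 - q)) (1 - q) = V n1 n2 (d + q) q"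
      by (simp add: V_def algebra_simps)
    moreover have "(- ph - - d)\<^sup>2 = (ph - d)\<^sup>2"
      by (simp add: power2_eq_square algebra_simps)
    ultimately show ?thesis
      unfolding mem_differences_iff using q by (intro exI[of _ "1 - q"]) auto
  qed
  from this[of d "-ph"] this[of "-d" ph] show ?thesis by auto
qed

lemma interior_gap_reflect: "interior_gap n1 n2 (- ph) z d = interior_gap n1 n2 ph z (- d)"
  by (simp add: interior_gap_def power2_eq_square algebra_simps)

lemma rad2_eq_rad1_reflect: "rad2 n1 n2 ph z = rad1 n1 n2 (- ph) z"
  by (simp add: rad1_def rad2_def algebra_simps)

lemma rad3_reflect: "rad3 n1 n2 (- ph) z = rad3 n1 n2 ph z"
  by (simp add: rad3_def Xi_def)

lemma L2_eq_reflect: "L2 n1 n2 ph z = - U1 n1 n2 (- ph) z"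
proof -
  have "n_min n1 n2 * ph - z\<^sup>2 / 2 = - (n_min n1 n2 * (- ph) + z\<^sup>2 / 2)" by simp
  then show ?thesis
    unfolding L2_def U1_def rad2_eq_rad1_reflect by (simp only: minus_divide_left[symmetric])
qed

lemma U2_eq_reflect: "U2 n1 n2 ph z = - L1 n1 n2 (- ph) z"
proof -
  have "n_min n1 n2 * ph - z\<^sup>2 / 2 = - (n_min n1 n2 * (- ph) + z\<^sup>2 / 2)" by simp
  then show ?thesis
    unfolding U2_def L1_def rad2_eq_rad1_reflect by (simp only: minus_divide_left[symmetric])
qed

lemma L3_eq_reflect: "L3 n1 n2 ph z = - U3 n1 n2 (- ph) z"
  unfolding L3_def U3_def rad3_reflect by simp

section \<open>The largest variance at a given difference\<close>

lemma interior_gap_alt: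
  "interior_gap n1 n2 ph z d = (ph - d)\<^sup>2 - z\<^sup>2 * ((1 / n1 + 1 / n2) / 4 - d\<^sup>2 / (n1 + n2))"
  by (cases "n1 \<le> n2") (simp_all add: interior_gap_def n_min_def n_max_def min_def max_def algebra_simps)

text \<open>Completing the square in the position \<open>q\<close> along the line \<open>p1 - p2 = d\<close>. The value of
  \<open>q\<close> that makes the square vanish is the vertex of the parabola.\<close>
lemma V_eq_interior:
  assumes "n1 > 0" "n2 > 0"
  shows "V n1 n2 (d + q) q = (1 / n1 + 1 / n2) / 4 - d\<^sup>2 / (n1 + n2)
      - (1 / n1 + 1 / n2) * (q - 1 / 2 + d * n2 / (n1 + n2))\<^sup>2"
proof -
  define a b c where "a = 1 / n1" "b = 1 / n2" "c = d / (n1 + n2)"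
  have d: "d = c * (n1 + n2)" and ab: "a * n1 = 1" "b * n2 = 1"
    using assms by (auto simp: a_b_c_def)
  have *: "V n1 n2 (d + q) q = (d + q) * (1 - (d + q)) * a + q * (1 - q) * b"
    "1 / n1 = a" "1 / n2 = b" "d\<^sup>2 / (n1 + n2) = c * d" "d * n2 / (n1 + n2) = c * n2"
    by (auto simp: V_def a_b_c_def power2_eq_square)
  have "4 * ((d + q) * (1 - (d + q)) * a + q * (1 - q) * b)
      = (a + b) - 4 * (c * d) - (a + b) * (2 * q - 1 + 2 * c * n2)\<^sup>2"
    using ab unfolding d by algebra
  then show ?thesis unfolding * by (simp add: power2_eq_square algebra_simps)
qed

lemma interior_gap_nonpos:
  assumes n: "n1 > 0" "n2 > 0" and d: "d \<in> differences n1 n2 ph z"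
  shows "interior_gap n1 n2 ph z d \<le> 0"
proof -
  from d obtain q where q: "(ph - d)\<^sup>2 \<le> z\<^sup>2 * V n1 n2 (d + q) q"
    by (auto simp: mem_differences_iff)
  have "V n1 n2 (d + q) q \<le> (1 / n1 + 1 / n2) / 4 - d\<^sup>2 / (n1 + n2)"
    using n by (simp add: V_eq_interior)
  then have "z\<^sup>2 * V n1 n2 (d + q) q \<le> z\<^sup>2 * ((1 / n1 + 1 / n2) / 4 - d\<^sup>2 / (n1 + n2))"
    by (intro mult_left_mono) auto
  with q show ?thesis by (simp add: interior_gap_alt)
qed

text \<open>The bound on \<open>d\<close> is exactly what places the vertex of the parabola inside the unit
  square.\<close>
lemma differences_interiorI:
  assumes n: "n1 > 0" "n2 > 0" and d: "\<bar>d\<bar> \<le> p_square n1 n2"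
    and gap: "interior_gap n1 n2 ph z d \<le> 0"
  shows "d \<in> differences n1 n2 ph z"
proof -
  \<comment> \<open>The position of the vertex of the parabola.\<close>
  define q where "q = 1 / 2 - d * n2 / (n1 + n2)"
  have p: "p_square n1 n2 * n1 \<le> (n1 + n2) / 2" "p_square n1 n2 * n2 \<le> (n1 + n2) / 2"
    using n unfolding p_square_def n_max_def n_min_def
    by (auto simp: field_simps max_def min_def intro: mult_mono)
  have "\<bar>d\<bar> * n1 \<le> p_square n1 n2 * n1" "\<bar>d\<bar> * n2 \<le> p_square n1 n2 * n2"
    using n d by (auto intro!: mult_right_mono)
  with p have "\<bar>d\<bar> * n1 \<le> (n1 + n2) / 2" "\<bar>d\<bar> * n2 \<le> (n1 + n2) / 2"
    by linarith+
  then have "\<bar>d * n1\<bar> \<le> (n1 + n2) / 2" "\<bar>d * n2\<bar> \<le> (n1 + n2) / 2"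
    using n by (auto simp: abs_mult)
  moreover have "d + q = 1 / 2 + d * n1 / (n1 + n2)"
    using n by (simp add: q_def field_simps)
  ultimately have "q \<in> {0..1}" "d + q \<in> {0..1}"
    using n by (auto simp: q_def field_simps abs_le_iff)
  moreover have "V n1 n2 (d + q) q = (1 / n1 + 1 / n2) / 4 - d\<^sup>2 / (n1 + n2)"
    using n by (simp add: V_eq_interior q_def)
  then have "(ph - d)\<^sup>2 \<le> z\<^sup>2 * V n1 n2 (d + q) q"
    using gap by (simp add: interior_gap_alt)
  ultimately show ?thesis by (auto simp: mem_differences_iff)
qed

text \<open>Beyond \<open>p_square\<close> the variance decreases as one moves from the end of the segment into
  the square, since its derivative there is already non-positive.\<close>
lemma edge_gap_nonpos:
  assumes n: "n1 > 0" "n2 > 0" and d: "d \<in> differences n1 n2 ph z" and p: "p_square n1 n2 \<le> d"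
  shows "edge_gap n1 n2 ph z d \<le> 0"
proof -
  have *: "edge_gap n1 n2 ph z d \<le> 0"
    if n: "0 < n1" "n1 \<le> n2" and d: "d \<in> differences n1 n2 ph z" and p: "p_square n1 n2 \<le> d"
    for n1 n2
  proof -
    from d obtain q where q: "(ph - d)\<^sup>2 \<le> z\<^sup>2 * V n1 n2 (d + q) q" "0 \<le> q"
      by (auto simp: mem_differences_iff)
    have slope: "(1 - 2 * d) / n1 + 1 / n2 \<le> 0"
      using n p by (simp add: p_square_def n_max_def n_min_def min_def max_def field_simps split: if_splits)
    have "V n1 n2 (d + q) q
        = d * (1 - d) / n1 + q * ((1 - 2 * d) / n1 + 1 / n2) - q\<^sup>2 * (1 / n1 + 1 / n2)"
      using n by (simp add: V_def field_simps power2_eq_square)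
    moreover have "q * ((1 - 2 * d) / n1 + 1 / n2) \<le> 0"
      using slope \<open>0 \<le> q\<close> by (rule mult_nonneg_nonpos[rotated])
    moreover have "0 \<le> q\<^sup>2 * (1 / n1 + 1 / n2)"
      using n by simp
    ultimately have "V n1 n2 (d + q) q \<le> d * (1 - d) / n1" by linarith
    then have "z\<^sup>2 * V n1 n2 (d + q) q \<le> z\<^sup>2 * (d * (1 - d) / n1)"
      by (rule mult_left_mono) simp
    with q n show ?thesis by (simp add: edge_gap_def n_min_def)
  qed
  show ?thesis
  proof (cases "n1 \<le> n2")
    case True
    then show ?thesis using * n d p by blast
  next
    case False
    then have "edge_gap n2 n1 ph z d \<le> 0"
      using *[of n2 n1] n d p
      by (simp add: differences_commute[of n1 n2] p_square_def n_min_commute n_max_commute)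
    then show ?thesis by (simp add: edge_gap_def n_min_commute)
  qed
qed

lemma edge_gap_nonpos_imp_unit:
  assumes n: "n1 > 0" "n2 > 0" and gap: "edge_gap n1 n2 ph z d \<le> 0" and z: "0 < z"
  shows "d \<in> {0..1}"
proof -
  have "0 \<le> z\<^sup>2 * (d * (1 - d) / n_min n1 n2)"
    using gap zero_le_power2[of "ph - d"] unfolding edge_gap_def by linarith
  then have "0 \<le> d * (1 - d)"
    using z n_min_pos[OF n] by (simp add: zero_le_mult_iff zero_le_divide_iff)
  then show ?thesis by (auto simp: zero_le_mult_iff)
qed

lemma differences_edgeI:
  assumes n: "n1 > 0" "n2 > 0" and d: "d \<in> {0..1}" and gap: "edge_gap n1 n2 ph z d \<le> 0"
  shows "d \<in> differences n1 n2 ph z"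
proof -
  have *: "d \<in> differences n1 n2 ph z" if "n1 \<le> n2" "edge_gap n1 n2 ph z d \<le> 0" for n1 n2
    using that d unfolding mem_differences_iff
    \<comment> \<open>The point \<open>(d, 0)\<close>: the second sample is the larger one.\<close>
    by (intro exI[of _ 0]) (simp add: V_def edge_gap_def n_min_def)
  show ?thesis
    using *[of n1 n2] *[of n2 n1] gap
    by (cases "n1 \<le> n2")
       (simp_all add: differences_commute[of n1 n2] edge_gap_def n_min_commute)
qed

text \<open>The double zero at \<open>p_square\<close> reflects that the vertex of the parabola reaches the
  edge of the square at this difference.\<close>
lemma edge_gap_minus_interior_gap:
  assumes "n1 > 0" "n2 > 0"
  shows "edge_gap n1 n2 ph z d - interior_gap n1 n2 ph z d =
    z\<^sup>2 * (n_max n1 n2 / (n_min n1 n2 * (n_max n1 n2 + n_min n1 n2)) * (d - p_square n1 n2)\<^sup>2)"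
proof -
  define m M where "m = n_min n1 n2" "M = n_max n1 n2"
  have pos: "m > 0" "M > 0" using n_min_pos[OF assms] n_max_pos[OF assms] by (auto simp: m_M_def)
  define a b c where "a = 1 / m" "b = 1 / M" "c = 1 / (M + m)"
  have r: "a * m = 1" "b * M = 1" "c * (M + m) = 1"
    using pos by (auto simp: a_b_c_def)
  have e: "1 / M = b" "1 / m = a" "d\<^sup>2 / (M + m) = d\<^sup>2 * c" "d * (1 - d) / m = d * (1 - d) * a"
    "M / (m * (M + m)) = M * a * c" "(M + m) / (2 * M) = (M + m) * b / 2"
    by (auto simp: a_b_c_def)
  define x where "x = d - (M + m) * b / 2"
  have "2 * x = 2 * d - (M + m) * b" by (simp add: x_def)
  with r have "4 * ((b + a) / 4 - d\<^sup>2 * c - d * (1 - d) * a) = 4 * (M * a * c * x\<^sup>2)"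
    by algebra
  then have "(b + a) / 4 - d\<^sup>2 * c - d * (1 - d) * a = M * a * c * (d - (M + m) * b / 2)\<^sup>2"
    unfolding x_def by (rule mult_left_cancel[THEN iffD1, rotated]) simp
  moreover have "(x - z\<^sup>2 * v) - (x - z\<^sup>2 * w) = z\<^sup>2 * (w - v)" for x v w
    by (simp add: algebra_simps)
  ultimately show ?thesis
    unfolding edge_gap_def interior_gap_def p_square_def m_M_def[symmetric] e by simp
qed

lemma interior_gap_le_edge_gap:
  assumes n: "n1 > 0" "n2 > 0"
  shows "interior_gap n1 n2 ph z d \<le> edge_gap n1 n2 ph z d"
proof -
  have "0 \<le> edge_gap n1 n2 ph z d - interior_gap n1 n2 ph z d"
    unfolding edge_gap_minus_interior_gap[OF n]
    using n_min_pos[OF n] n_max_pos[OF n] by (intro mult_nonneg_nonneg divide_nonneg_nonneg) auto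
  then show ?thesis by simp
qed

lemma edge_gap_p_square:
  assumes "n1 > 0" "n2 > 0"
  shows "edge_gap n1 n2 ph z (p_square n1 n2) = interior_gap n1 n2 ph z (p_square n1 n2)"
  using edge_gap_minus_interior_gap[OF assms, of ph z "p_square n1 n2"] by simp

section \<open>Roots\<close>

text \<open>Quadratics are written with linear coefficient \<open>- 2 * b\<close>, so that the discriminant is
  \<open>b\<^sup>2 - a * c\<close> and the roots are \<open>(b \<plusminus> w) / a\<close>.\<close>
lemma quadratic_nonpos_imp_discriminant:
  fixes a b c x :: real
  assumes "0 < a" "a * x\<^sup>2 - 2 * b * x + c \<le> 0"
  shows "0 \<le> b\<^sup>2 - a * c"
proof -
  have "b\<^sup>2 - a * c = (a * x - b)\<^sup>2 - a * (a * x\<^sup>2 - 2 * b * x + c)"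
    by (simp add: power2_eq_square algebra_simps)
  moreover have "a * (a * x\<^sup>2 - 2 * b * x + c) \<le> 0"
    using assms by (simp add: mult_nonneg_nonpos)
  moreover have "0 \<le> (a * x - b)\<^sup>2" by simp
  ultimately show ?thesis by linarith
qed

lemma quadratic_nonpos_iff:
  fixes a b c w x :: real
  assumes "0 < a" "0 \<le> w" "w\<^sup>2 = b\<^sup>2 - a * c"
  shows "a * x\<^sup>2 - 2 * b * x + c \<le> 0 \<longleftrightarrow> (b - w) / a \<le> x \<and> x \<le> (b + w) / a"
proof -
  have "a * x\<^sup>2 - 2 * b * x + c \<le> 0 \<longleftrightarrow> a * (a * x\<^sup>2 - 2 * b * x + c) \<le> 0"
    using assms(1) by (simp add: mult_le_0_iff)
  also have "a * (a * x\<^sup>2 - 2 * b * x + c) = (a * x - b)\<^sup>2 - w\<^sup>2"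
    unfolding assms(3) by (simp add: power2_eq_square algebra_simps)
  also have "\<dots> \<le> 0 \<longleftrightarrow> \<bar>a * x - b\<bar> \<le> w"
    using abs_le_square_iff[of "a * x - b" w] assms(2) by simp
  also have "\<dots> \<longleftrightarrow> (b - w) / a \<le> x \<and> x \<le> (b + w) / a"
    using assms(1) by (auto simp: abs_le_iff field_simps)
  finally show ?thesis .
qed

lemma quadratic_neg_between:
  fixes a b c x t y :: real
  assumes "0 < a" "a * x\<^sup>2 - 2 * b * x + c \<le> 0" "a * y\<^sup>2 - 2 * b * y + c \<le> 0" "x < t" "t < y"
  shows "a * t\<^sup>2 - 2 * b * t + c < 0"
proof -
  have "(y - x) * (a * t\<^sup>2 - 2 * b * t + c)
      = (y - t) * (a * x\<^sup>2 - 2 * b * x + c) + (t - x) * (a * y\<^sup>2 - 2 * b * y + c)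
        - a * ((y - x) * (y - t) * (t - x))"
    by (simp add: power2_eq_square algebra_simps)
  moreover have "(y - t) * (a * x\<^sup>2 - 2 * b * x + c) \<le> 0" "(t - x) * (a * y\<^sup>2 - 2 * b * y + c) \<le> 0"
    using assms by (auto intro: mult_nonneg_nonpos)
  moreover have "0 < a * ((y - x) * (y - t) * (t - x))"
    using assms by simp
  ultimately have "(y - x) * (a * t\<^sup>2 - 2 * b * t + c) < 0" by linarith
  then show ?thesis using assms by (simp add: mult_less_0_iff)
qed

lemma edge_gap_quadratic:
  assumes "n1 > 0" "n2 > 0"
  shows "n_min n1 n2 * edge_gap n1 n2 ph z d =
    (n_min n1 n2 + z\<^sup>2) * d\<^sup>2 - 2 * (n_min n1 n2 * ph + z\<^sup>2 / 2) * d + n_min n1 n2 * ph\<^sup>2"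
  using n_min_pos[OF assms] unfolding edge_gap_def
  by (simp add: power2_eq_square field_simps)

lemma edge_discriminant:
  "(n_min n1 n2 * ph + z\<^sup>2 / 2)\<^sup>2 - (n_min n1 n2 + z\<^sup>2) * (n_min n1 n2 * ph\<^sup>2)
     = z\<^sup>2 * rad1 n1 n2 ph z / 4"
  unfolding rad1_def by (simp add: power2_eq_square field_simps)

lemma edge_gap_nonpos_imp_rad1:
  assumes n: "n1 > 0" "n2 > 0" "0 < z" and gap: "edge_gap n1 n2 ph z d \<le> 0"
  shows "0 \<le> rad1 n1 n2 ph z"
proof -
  have "n_min n1 n2 * edge_gap n1 n2 ph z d \<le> 0"
    using gap n_min_pos[OF n(1,2)] by (simp add: mult_le_0_iff)
  then have "0 \<le> z\<^sup>2 * rad1 n1 n2 ph z / 4"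
    unfolding edge_gap_quadratic[OF n(1,2)] edge_discriminant[symmetric]
    using n_min_pos[OF n(1,2)] by (intro quadratic_nonpos_imp_discriminant) (auto intro: add_pos_nonneg)
  then show ?thesis using \<open>0 < z\<close> by (simp add: zero_le_mult_iff)
qed

lemma edge_gap_nonpos_iff:
  assumes n: "n1 > 0" "n2 > 0" "0 < z" and rad: "0 \<le> rad1 n1 n2 ph z"
  shows "edge_gap n1 n2 ph z d \<le> 0 \<longleftrightarrow> L1 n1 n2 ph z \<le> d \<and> d \<le> U1 n1 n2 ph z"
proof -
  define w where "w = z * sqrt (rad1 n1 n2 ph z) / 2"
  define a where "a = n_min n1 n2 + z\<^sup>2"
  define b where "b = n_min n1 n2 * ph + z\<^sup>2 / 2"
  have a: "0 < a" using n_min_pos[OF n(1,2)] by (auto simp: a_def intro: add_pos_nonneg)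
  have w: "0 \<le> w" using \<open>0 < z\<close> rad by (simp add: w_def)
  have "w\<^sup>2 = z\<^sup>2 * rad1 n1 n2 ph z / 4"
    using rad by (simp add: w_def power_divide power_mult_distrib)
  then have w2: "w\<^sup>2 = b\<^sup>2 - a * (n_min n1 n2 * ph\<^sup>2)"
    by (simp only: edge_discriminant a_def b_def)
  have "edge_gap n1 n2 ph z d \<le> 0 \<longleftrightarrow> n_min n1 n2 * edge_gap n1 n2 ph z d \<le> 0"
    using n_min_pos[OF n(1,2)] by (simp add: mult_le_0_iff)
  also have "\<dots> \<longleftrightarrow> (b - w) / a \<le> d \<and> d \<le> (b + w) / a"
    unfolding edge_gap_quadratic[OF n(1,2)] a_def[symmetric] b_def[symmetric]
    by (rule quadratic_nonpos_iff[OF a w w2])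
  also have "(b - w) / a = L1 n1 n2 ph z"
    unfolding L1_def a_def[symmetric] b_def[symmetric] w_def by (simp add: diff_divide_distrib)
  also have "(b + w) / a = U1 n1 n2 ph z"
    unfolding U1_def a_def[symmetric] b_def[symmetric] w_def by (simp add: add_divide_distrib)
  finally show ?thesis .
qed

lemma interior_gap_quadratic:
  assumes "n1 > 0" "n2 > 0"
  shows "(n_max n1 n2 + n_min n1 n2) * interior_gap n1 n2 ph z d =
    (n_max n1 n2 + n_min n1 n2 + z\<^sup>2) * d\<^sup>2 - 2 * ((n_max n1 n2 + n_min n1 n2) * ph) * d
    + ((n_max n1 n2 + n_min n1 n2) * ph\<^sup>2
       - z\<^sup>2 * (n_max n1 n2 + n_min n1 n2)\<^sup>2 / (4 * (n_max n1 n2 * n_min n1 n2)))"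
proof -
  define m M where "m = n_min n1 n2" "M = n_max n1 n2"
  have pos: "m > 0" "M > 0" using n_min_pos[OF assms] n_max_pos[OF assms] by (auto simp: m_M_def)
  define k t y where "k = 1 / M + 1 / m" "t = d\<^sup>2 / (M + m)" "y = z\<^sup>2 * (M + m)\<^sup>2 / (4 * (M * m))"
  have "k = (M + m) / (M * m)" using pos by (simp add: k_t_y_def field_simps)
  then have y: "y = z\<^sup>2 * (M + m) * (k / 4)"
    by (simp add: k_t_y_def power2_eq_square)
  have t: "(M + m) * t = d\<^sup>2" using pos by (simp add: k_t_y_def)
  have "(M + m) * ((ph - d)\<^sup>2 - z\<^sup>2 * (k / 4 - t))
      = (M + m + z\<^sup>2) * d\<^sup>2 - 2 * ((M + m) * ph) * d + ((M + m) * ph\<^sup>2 - y)"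
    using t unfolding y by algebra
  then show ?thesis unfolding interior_gap_def m_M_def k_t_y_def .
qed

lemma interior_discriminant:
  assumes "n1 > 0" "n2 > 0"
  shows "((n_max n1 n2 + n_min n1 n2) * ph)\<^sup>2 - (n_max n1 n2 + n_min n1 n2 + z\<^sup>2) *
      ((n_max n1 n2 + n_min n1 n2) * ph\<^sup>2
       - z\<^sup>2 * (n_max n1 n2 + n_min n1 n2)\<^sup>2 / (4 * (n_max n1 n2 * n_min n1 n2)))
     = z\<^sup>2 * rad3 n1 n2 ph z / 4"
proof -
  define m M where "m = n_min n1 n2" "M = n_max n1 n2"
  have pos: "m > 0" "M > 0" using n_min_pos[OF assms] n_max_pos[OF assms] by (auto simp: m_M_def)
  define c where "c = 1 / (M * m)"
  have c: "c * (M * m) = 1" using pos by (simp add: c_def)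
  have e: "z\<^sup>2 * (M + m)\<^sup>2 / (4 * (M * m)) = z\<^sup>2 * (M + m)\<^sup>2 * c / 4"
    "(M + m) * ((M + m) * (M + m + z\<^sup>2) - 4 * M * m * ph\<^sup>2) / (M * m)
       = (M + m) * ((M + m) * (M + m + z\<^sup>2) - 4 * M * m * ph\<^sup>2) * c"
    by (simp_all add: c_def)
  define y where "y = z\<^sup>2 * (M + m)\<^sup>2 * c / 4"
  have "4 * y = z\<^sup>2 * (M + m)\<^sup>2 * c" by (simp add: y_def)
  with c have "4 * (((M + m) * ph)\<^sup>2 - (M + m + z\<^sup>2) * ((M + m) * ph\<^sup>2 - y))
    = 4 * (z\<^sup>2 * ((M + m) * ((M + m) * (M + m + z\<^sup>2) - 4 * M * m * ph\<^sup>2) * c) / 4)"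
    by algebra
  then show ?thesis unfolding rad3_def Xi_def m_M_def[symmetric] e y_def[symmetric]
    by (rule mult_left_cancel[THEN iffD1, rotated]) simp
qed

lemma interior_gap_nonpos_imp_rad3:
  assumes n: "n1 > 0" "n2 > 0" "0 < z" and gap: "interior_gap n1 n2 ph z d \<le> 0"
  shows "0 \<le> rad3 n1 n2 ph z"
proof -
  have pos: "0 < n_max n1 n2 + n_min n1 n2"
    using n_min_pos[OF n(1,2)] n_max_pos[OF n(1,2)] by simp
  have "(n_max n1 n2 + n_min n1 n2) * interior_gap n1 n2 ph z d \<le> 0"
    using gap pos by (simp add: mult_le_0_iff)
  then have "0 \<le> z\<^sup>2 * rad3 n1 n2 ph z / 4"
    unfolding interior_gap_quadratic[OF n(1,2)] interior_discriminant[OF n(1,2), symmetric]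
    using pos by (intro quadratic_nonpos_imp_discriminant) (auto intro: add_pos_nonneg)
  then show ?thesis using \<open>0 < z\<close> by (simp add: zero_le_mult_iff)
qed

lemma interior_gap_nonpos_iff:
  assumes n: "n1 > 0" "n2 > 0" "0 < z" and rad: "0 \<le> rad3 n1 n2 ph z"
  shows "interior_gap n1 n2 ph z d \<le> 0 \<longleftrightarrow> L3 n1 n2 ph z \<le> d \<and> d \<le> U3 n1 n2 ph z"
proof -
  define w where "w = z / 2 * sqrt (rad3 n1 n2 ph z)"
  define s where "s = n_max n1 n2 + n_min n1 n2"
  define a where "a = s + z\<^sup>2"
  define b where "b = s * ph"
  define c where "c = s * ph\<^sup>2 - z\<^sup>2 * s\<^sup>2 / (4 * (n_max n1 n2 * n_min n1 n2))"
  have s: "0 < s" using n_min_pos[OF n(1,2)] n_max_pos[OF n(1,2)] by (simp add: s_def)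
  then have a: "0 < a" by (auto simp: a_def intro: add_pos_nonneg)
  have w: "0 \<le> w" using \<open>0 < z\<close> rad by (simp add: w_def)
  have "w\<^sup>2 = z\<^sup>2 * rad3 n1 n2 ph z / 4"
    using rad by (simp add: w_def power_divide power_mult_distrib)
  then have w2: "w\<^sup>2 = b\<^sup>2 - a * c"
    by (simp only: interior_discriminant[OF n(1,2)] a_def b_def c_def s_def)
  have "interior_gap n1 n2 ph z d \<le> 0 \<longleftrightarrow> s * interior_gap n1 n2 ph z d \<le> 0"
    using s by (simp add: mult_le_0_iff)
  also have "\<dots> \<longleftrightarrow> (b - w) / a \<le> d \<and> d \<le> (b + w) / a"
    unfolding s_def interior_gap_quadratic[OF n(1,2)]
    unfolding s_def[symmetric] a_def[symmetric] b_def[symmetric] c_def[symmetric]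
    by (rule quadratic_nonpos_iff[OF a w w2])
  also have "(b - w) / a = L3 n1 n2 ph z"
    unfolding L3_def s_def[symmetric] a_def[symmetric] b_def[symmetric] w_def
    by (simp add: diff_divide_distrib)
  also have "(b + w) / a = U3 n1 n2 ph z"
    unfolding U3_def s_def[symmetric] a_def[symmetric] b_def[symmetric] w_def
    by (simp add: add_divide_distrib)
  finally show ?thesis .
qed

text \<open>Strictness is what excludes every attained difference below \<open>p_square\<close> in
  \<open>smallest_L1\<close>, even when the gap is zero at \<open>p_square\<close> itself.\<close>
lemma interior_gap_neg_between:
  assumes n: "n1 > 0" "n2 > 0"
    and gap: "interior_gap n1 n2 ph z x \<le> 0" "interior_gap n1 n2 ph z y \<le> 0" and t: "x < t" "t < y"
  shows "interior_gap n1 n2 ph z t < 0"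
proof -
  have pos: "0 < n_max n1 n2 + n_min n1 n2"
    using n_min_pos[OF n] n_max_pos[OF n] by simp
  then have "(n_max n1 n2 + n_min n1 n2) * interior_gap n1 n2 ph z x \<le> 0"
    "(n_max n1 n2 + n_min n1 n2) * interior_gap n1 n2 ph z y \<le> 0"
    using gap by (simp_all add: mult_le_0_iff)
  then have "(n_max n1 n2 + n_min n1 n2) * interior_gap n1 n2 ph z t < 0"
    unfolding interior_gap_quadratic[OF n]
    using pos t by (intro quadratic_neg_between[of _ x _ _ y t]) (auto intro: add_pos_nonneg)
  then show ?thesis using pos by (simp add: mult_less_0_iff)
qed

lemma L1_le_U1:
  assumes "n1 > 0" "n2 > 0" "0 < z" "0 \<le> rad1 n1 n2 ph z"
  shows "L1 n1 n2 ph z \<le> U1 n1 n2 ph z"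
proof -
  have "0 \<le> z * sqrt (rad1 n1 n2 ph z) / (2 * (n_min n1 n2 + z\<^sup>2))"
    using assms n_min_pos[OF assms(1,2)] by (intro divide_nonneg_nonneg mult_nonneg_nonneg) auto
  moreover have "x - t \<le> x + t" if "0 \<le> t" for x t :: real using that by simp
  ultimately show ?thesis unfolding L1_def U1_def by blast
qed

section \<open>Extreme differences\<close>

definition greatest :: "real set \<Rightarrow> real \<Rightarrow> bool" where
  "greatest D u \<longleftrightarrow> u \<in> D \<and> (\<forall>d\<in>D. d \<le> u)"

definition smallest :: "real set \<Rightarrow> real \<Rightarrow> bool" where
  "smallest D l \<longleftrightarrow> l \<in> D \<and> (\<forall>d\<in>D. l \<le> d)"

lemma minimum_value_iff: "minimum_value f S m \<longleftrightarrow> smallest (f ` S) m"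
  by (auto simp: minimum_value_def smallest_def)

lemma maximum_value_iff: "maximum_value f S m \<longleftrightarrow> greatest (f ` S) m"
  by (auto simp: maximum_value_def greatest_def)

lemma optimal_values_iff:
  "optimal_values n1 n2 ph z (L, U) \<longleftrightarrow>
     smallest (differences n1 n2 ph z) L \<and> greatest (differences n1 n2 ph z) U"
  by (simp add: optimal_values_def minimum_value_iff maximum_value_iff differences_def)

lemma smallest_reflect:
  "smallest (differences n1 n2 ph z) l \<longleftrightarrow> greatest (differences n1 n2 (- ph) z) (- l)"
  unfolding smallest_def greatest_def
  using differences_reflect[of _ n1 n2 ph z] by (metis minus_le_iff minus_minus neg_le_iff_le)

lemma greatest_reflect:
  "greatest (differences n1 n2 ph z) u \<longleftrightarrow> smallest (differences n1 n2 (- ph) z) (- u)"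
  by (simp add: smallest_reflect)

locale interval_data =
  fixes n1 n2 z :: real
  assumes n1: "n1 > 0" and n2: "n2 > 0" and z: "z > 0"
begin

lemma edge_gap_at_ph:
  assumes "0 \<le> ph" "ph \<le> 1"
  shows "edge_gap n1 n2 ph z ph \<le> 0"
  using assms n_min_pos[OF n1 n2] by (simp add: edge_gap_def)

text \<open>Either \<open>ph\<close> itself or \<open>p_square\<close> is a point of the upper range with non-positive edge
  gap. The larger root of the edge quadratic then lies in the upper range, and it bounds the
  attained differences of all ranges.\<close>
lemma greatest_U1:
  assumes ph: "- 1 \<le> ph" "ph \<le> 1"
    and reach: "p_square n1 n2 \<le> ph \<or> interior_gap n1 n2 ph z (p_square n1 n2) \<le> 0"
  shows "0 \<le> rad1 n1 n2 ph z \<and> greatest (differences n1 n2 ph z) (U1 n1 n2 ph z)"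
proof -
  let ?p = "p_square n1 n2"
  obtain d0 where d0: "?p \<le> d0" "edge_gap n1 n2 ph z d0 \<le> 0"
    using reach edge_gap_at_ph[of ph] edge_gap_p_square[OF n1 n2, of ph z] p_square_pos[OF n1 n2] ph
    by (metis dual_order.trans le_less order_refl)
  have rad: "0 \<le> rad1 n1 n2 ph z"
    using edge_gap_nonpos_imp_rad1[OF n1 n2 z d0(2)] .
  note iff = edge_gap_nonpos_iff[OF n1 n2 z rad]
  have le: "?p \<le> U1 n1 n2 ph z" using d0 iff by (meson order_trans)
  have gap: "edge_gap n1 n2 ph z (U1 n1 n2 ph z) \<le> 0"
    using iff L1_le_U1[OF n1 n2 z rad] by simp
  then have "U1 n1 n2 ph z \<in> differences n1 n2 ph z"
    using differences_edgeI[OF n1 n2] edge_gap_nonpos_imp_unit[OF n1 n2 _ z] by blast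
  moreover have "d \<le> U1 n1 n2 ph z" if "d \<in> differences n1 n2 ph z" for d
    using edge_gap_nonpos[OF n1 n2 that] iff le by (meson linear order_trans)
  ultimately show ?thesis using rad by (simp add: greatest_def)
qed

text \<open>The middle range contains a point with non-positive interior gap, but its right end
  has positive gap. So the larger root lies in the middle range. It is an upper bound
  because the interior gap is non-positive at every attained difference.\<close>
lemma greatest_U3:
  assumes ph: "- 1 \<le> ph" "ph < p_square n1 n2"
    and short: "0 < interior_gap n1 n2 ph z (p_square n1 n2)"
    and reach: "- p_square n1 n2 \<le> ph \<or> interior_gap n1 n2 ph z (- p_square n1 n2) \<le> 0"
  shows "0 \<le> rad3 n1 n2 ph z \<and> greatest (differences n1 n2 ph z) (U3 n1 n2 ph z)"
proof -
  let ?p = "p_square n1 n2"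
  have at_ph: "interior_gap n1 n2 ph z ph \<le> 0" if "- ?p \<le> ph"
  proof (cases "0 \<le> ph")
    case True
    then have "edge_gap n1 n2 ph z ph \<le> 0"
      using edge_gap_at_ph[of ph] ph p_square_le_1[OF n1 n2] by linarith
    then show ?thesis using interior_gap_le_edge_gap[OF n1 n2, of ph z ph] by linarith
  next
    case False
    then have "edge_gap n1 n2 (- ph) z (- ph) \<le> 0"
      using edge_gap_at_ph[of "- ph"] ph by linarith
    then show ?thesis
      using interior_gap_le_edge_gap[OF n1 n2, of "- ph" z "- ph"] by (simp add: interior_gap_reflect)
  qed
  obtain d0 where d0: "- ?p \<le> d0" "d0 \<le> ?p" "interior_gap n1 n2 ph z d0 \<le> 0"
    using reach at_ph ph p_square_pos[OF n1 n2]
    by (metis less_imp_le neg_le_0_iff_le order_refl order_trans)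
  have rad: "0 \<le> rad3 n1 n2 ph z"
    using interior_gap_nonpos_imp_rad3[OF n1 n2 z d0(3)] .
  note iff = interior_gap_nonpos_iff[OF n1 n2 z rad]
  have "L3 n1 n2 ph z \<le> d0" "d0 \<le> U3 n1 n2 ph z" using d0 iff by auto
  moreover have "\<not> (L3 n1 n2 ph z \<le> ?p \<and> ?p \<le> U3 n1 n2 ph z)"
    using iff[of ?p] short by linarith
  ultimately have u: "- ?p \<le> U3 n1 n2 ph z" "U3 n1 n2 ph z \<le> ?p" "L3 n1 n2 ph z \<le> U3 n1 n2 ph z"
    using d0 by linarith+
  then have "U3 n1 n2 ph z \<in> differences n1 n2 ph z"
    using differences_interiorI[OF n1 n2, of "U3 n1 n2 ph z"] iff by (simp add: abs_le_iff)
  moreover have "d \<le> U3 n1 n2 ph z" if "d \<in> differences n1 n2 ph z" for d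
    using interior_gap_nonpos[OF n1 n2 that] iff by blast
  ultimately show ?thesis using rad by (simp add: greatest_def)
qed

text \<open>The interior gap is non-positive at \<open>ph\<close> and non-negative at \<open>p_square\<close>, so by
  convexity it is positive below \<open>p_square\<close>: only the upper range contains attained
  differences.\<close>
lemma smallest_L1:
  assumes ph: "p_square n1 n2 < ph" "ph \<le> 1"
    and far: "0 \<le> interior_gap n1 n2 ph z (p_square n1 n2)"
  shows "0 \<le> rad1 n1 n2 ph z \<and> smallest (differences n1 n2 ph z) (L1 n1 n2 ph z)"
proof -
  let ?p = "p_square n1 n2"
  have edge_ph: "edge_gap n1 n2 ph z ph \<le> 0"
    using edge_gap_at_ph[of ph] ph p_square_pos[OF n1 n2] by linarith
  have rad: "0 \<le> rad1 n1 n2 ph z"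
    using edge_gap_nonpos_imp_rad1[OF n1 n2 z edge_ph] .
  note iff = edge_gap_nonpos_iff[OF n1 n2 z rad]
  have int_ph: "interior_gap n1 n2 ph z ph \<le> 0"
    using edge_ph interior_gap_le_edge_gap[OF n1 n2, of ph z ph] by linarith
  have below: "0 < interior_gap n1 n2 ph z d" if "d < ?p" for d
    using interior_gap_neg_between[OF n1 n2 _ int_ph that ph(1)] far by linarith
  have "L1 n1 n2 ph z \<in> differences n1 n2 ph z"
    using differences_edgeI[OF n1 n2] edge_gap_nonpos_imp_unit[OF n1 n2 _ z] iff
      L1_le_U1[OF n1 n2 z rad] by blast
  moreover have "L1 n1 n2 ph z \<le> d" if "d \<in> differences n1 n2 ph z" for d
  proof -
    have "?p \<le> d"
      using interior_gap_nonpos[OF n1 n2 that] below[of d] by linarith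
    then show ?thesis
      using edge_gap_nonpos[OF n1 n2 that] iff by blast
  qed
  ultimately show ?thesis using rad by (simp add: smallest_def)
qed

end

section \<open>Thresholds\<close>

text \<open>Clearing the denominator is valid also for \<open>s = 0\<close>: with \<open>a / 0 = \<infinity>\<close> for \<open>a > 0\<close> and
  \<open>0 / 0 = 0\<close>, both sides then say \<open>a = 0\<close>. This is how equal sample sizes need no separate
  treatment.\<close>
lemma ereal_ratio_le_iff:
  fixes a s z :: real
  assumes "0 \<le> a" "0 \<le> s" "0 < z"
  shows "ereal a / ereal (sqrt s) \<le> ereal z \<longleftrightarrow> a\<^sup>2 \<le> z\<^sup>2 * s"
proof (cases "s = 0")
  case True
  then show ?thesis
    using assms by (cases "a = 0") (auto simp: divide_ereal_def zero_ereal_def[symmetric])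
next
  case False
  then have "ereal a / ereal (sqrt s) \<le> ereal z \<longleftrightarrow> a \<le> z * sqrt s"
    using assms by (simp add: pos_divide_le_eq)
  also have "\<dots> \<longleftrightarrow> a\<^sup>2 \<le> (z * sqrt s)\<^sup>2"
    using assms by (simp add: abs_le_square_iff[symmetric])
  finally show ?thesis
    using assms by (simp add: power_mult_distrib)
qed

text \<open>Only this direction holds for strict inequalities, since for \<open>a = s = 0\<close> the ratio is
  0 and hence less than \<open>z\<close>. For \<open>R1\<close>, equal sample sizes with \<open>\<bar>ph\<bar> = 1\<close> are of this kind.\<close>
lemma ereal_ratio_less:
  fixes a s z :: real
  assumes "0 \<le> a" "0 \<le> s" "0 < z" "a\<^sup>2 < z\<^sup>2 * s"
  shows "ereal a / ereal (sqrt s) < ereal z"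
proof -
  have s: "0 < s" using assms by (cases "s = 0") auto
  have "a\<^sup>2 < (z * sqrt s)\<^sup>2" using assms by (simp add: power_mult_distrib)
  then have "a < z * sqrt s" using assms by (simp add: power2_less_imp_less)
  then show ?thesis using s by (simp add: pos_divide_less_eq)
qed

lemma ereal_ratio_mono:
  fixes a b s :: real
  assumes "0 \<le> a" "a < b" "0 \<le> s"
  shows "ereal a / ereal (sqrt s) < ereal b / ereal (sqrt s) \<or> ereal b / ereal (sqrt s) = \<infinity>"
proof (cases "s = 0")
  case True
  then show ?thesis using assms by (auto simp: divide_ereal_def zero_ereal_def[symmetric])
next
  case False
  then show ?thesis using assms by (simp add: divide_strict_right_mono)
qed

lemma ereal_ratio_pos:
  fixes a s :: real
  assumes "0 < a" "0 \<le> s"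
  shows "0 < ereal a / ereal (sqrt s)"
  using assms by (cases "s = 0") (auto simp: divide_ereal_def zero_ereal_def[symmetric])

text \<open>Multiplied by a positive constant, the gap at \<open>p_square\<close> is the difference between the
  squared numerator of \<open>R1\<close> (for \<open>ph \<ge> 0\<close>) or \<open>R2\<close> (for \<open>ph \<le> 0\<close>) and \<open>z\<^sup>2\<close> times their
  squared denominator. It is computed from the edge gap, which has the same value there and
  a simpler formula.\<close>
lemma interior_gap_p_square:
  assumes "n1 > 0" "n2 > 0"
  shows "4 * (n_max n1 n2)\<^sup>2 * n_min n1 n2 * interior_gap n1 n2 ph z (p_square n1 n2) =
    n_min n1 n2 * (2 * n_max n1 n2 * ph - (n_max n1 n2 + n_min n1 n2))\<^sup>2
    - z\<^sup>2 * ((n_max n1 n2)\<^sup>2 - (n_min n1 n2)\<^sup>2)"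
proof -
  define m M where "m = n_min n1 n2" "M = n_max n1 n2"
  have pos: "m > 0" "M > 0" using n_min_pos[OF assms] n_max_pos[OF assms] by (auto simp: m_M_def)
  define p where "p = (M + m) / (2 * M)"
  have p: "2 * M * p = M + m" using pos by (simp add: p_def)
  have "edge_gap n1 n2 ph z p = (ph - p)\<^sup>2 - z\<^sup>2 * (p * (1 - p) / m)"
    by (simp add: edge_gap_def m_M_def)
  moreover have "m * (x - z\<^sup>2 * (y / m)) = m * x - z\<^sup>2 * y" for x y
    using pos by (simp add: field_simps)
  ultimately have "m * edge_gap n1 n2 ph z p = m * (ph - p)\<^sup>2 - z\<^sup>2 * (p * (1 - p))"
    by simp
  then have "4 * M\<^sup>2 * m * edge_gap n1 n2 ph z p = m * (2 * M * ph - (M + m))\<^sup>2 - z\<^sup>2 * (M\<^sup>2 - m\<^sup>2)"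
    using p by algebra
  then show ?thesis
    using edge_gap_p_square[OF assms, of ph z] unfolding p_def p_square_def m_M_def by simp
qed

lemma n_square_diff_nonneg:
  assumes "n1 > 0" "n2 > 0"
  shows "0 \<le> (n_max n1 n2)\<^sup>2 - (n_min n1 n2)\<^sup>2"
  using n_min_pos[OF assms] n_min_le_n_max[of n1 n2] by (simp add: power_mono)

lemma R_reflect: "R1 n1 n2 (- ph) = R1 n1 n2 ph" "R2 n1 n2 (- ph) = R2 n1 n2 ph"
  by (simp_all add: R1_def R2_def)

context interval_data
begin

lemma gap_scale: "0 < 4 * (n_max n1 n2)\<^sup>2 * n_min n1 n2"
  using n_min_pos[OF n1 n2] n_max_pos[OF n1 n2] by simp

lemma scaled_gap_nonpos_iff: "4 * (n_max n1 n2)\<^sup>2 * n_min n1 n2 * x \<le> 0 \<longleftrightarrow> x \<le> 0"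
  using mult_le_cancel_left_pos[OF gap_scale, of x 0] by (simp only: mult_zero_right)

lemma R1_le_iff:
  assumes "0 \<le> ph"
  shows "R1 n1 n2 ph \<le> ereal z \<longleftrightarrow> interior_gap n1 n2 ph z (p_square n1 n2) \<le> 0"
proof -
  have "R1 n1 n2 ph \<le> ereal z \<longleftrightarrow>
      4 * (n_max n1 n2)\<^sup>2 * n_min n1 n2 * interior_gap n1 n2 ph z (p_square n1 n2) \<le> 0"
    unfolding R1_def using assms n_min_pos[OF n1 n2]
    by (subst ereal_ratio_le_iff[OF _ n_square_diff_nonneg[OF n1 n2] z])
       (simp_all add: interior_gap_p_square[OF n1 n2] power_mult_distrib)
  then show ?thesis unfolding scaled_gap_nonpos_iff .
qed

lemma le_R1_imp:
  assumes "0 \<le> ph" "ereal z \<le> R1 n1 n2 ph"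
  shows "0 \<le> interior_gap n1 n2 ph z (p_square n1 n2)"
proof (rule ccontr)
  assume "\<not> 0 \<le> interior_gap n1 n2 ph z (p_square n1 n2)"
  then have "4 * (n_max n1 n2)\<^sup>2 * n_min n1 n2 * interior_gap n1 n2 ph z (p_square n1 n2) < 0"
    using gap_scale by (simp only: mult_less_0_iff) simp
  then have "R1 n1 n2 ph < ereal z"
    unfolding R1_def interior_gap_p_square[OF n1 n2]
    using assms(1) n_min_pos[OF n1 n2]
    by (intro ereal_ratio_less[OF _ n_square_diff_nonneg[OF n1 n2] z])
       (simp_all add: power_mult_distrib)
  with assms(2) show False by simp
qed

lemma R2_le_iff:
  assumes "0 \<le> ph"
  shows "R2 n1 n2 ph \<le> ereal z \<longleftrightarrow> interior_gap n1 n2 ph z (- p_square n1 n2) \<le> 0"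
proof -
  have sq: "(2 * n_max n1 n2 * (- ph) - (n_max n1 n2 + n_min n1 n2))\<^sup>2
      = (2 * n_max n1 n2 * ph + (n_max n1 n2 + n_min n1 n2))\<^sup>2"
    by (simp add: power2_eq_square algebra_simps)
  have "R2 n1 n2 ph \<le> ereal z \<longleftrightarrow>
      4 * (n_max n1 n2)\<^sup>2 * n_min n1 n2 * interior_gap n1 n2 (- ph) z (p_square n1 n2) \<le> 0"
    unfolding R2_def interior_gap_p_square[OF n1 n2] sq
    using assms n_min_pos[OF n1 n2] n_max_pos[OF n1 n2]
    by (subst ereal_ratio_le_iff[OF _ n_square_diff_nonneg[OF n1 n2] z])
       (simp_all add: power_mult_distrib)
  then show ?thesis unfolding scaled_gap_nonpos_iff interior_gap_reflect .
qed

lemma interior_gap_mono: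
  assumes "0 \<le> ph"
  shows "interior_gap n1 n2 ph z (p_square n1 n2) \<le> interior_gap n1 n2 ph z (- p_square n1 n2)"
proof -
  have "\<bar>ph - p_square n1 n2\<bar> \<le> \<bar>ph - - p_square n1 n2\<bar>"
    using assms p_square_pos[OF n1 n2] by linarith
  then show ?thesis unfolding interior_gap_def by (simp add: abs_le_square_iff)
qed

lemma R2_le_imp:
  assumes "R2 n1 n2 ph \<le> ereal z"
  shows "interior_gap n1 n2 ph z (p_square n1 n2) \<le> 0"
proof (cases "0 \<le> ph")
  case True
  then show ?thesis using assms R2_le_iff interior_gap_mono[of ph] by force
next
  case False
  then show ?thesis
    using assms R2_le_iff[of "- ph"] by (simp add: R_reflect interior_gap_reflect)
qed

text \<open>From here on the reachability conditions are phrased through the thresholds. For \<open>ph \<ge>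
  0\<close> the point \<open>p_square\<close> is the near one of \<open>\<plusminus>p_square\<close> and belongs to \<open>R1\<close>; for \<open>ph \<le> 0\<close>
  it is the far one and belongs to \<open>R2\<close>.\<close>
lemma upper_U1:
  assumes ph: "- 1 \<le> ph" "ph \<le> 1"
    and "p_square n1 n2 \<le> ph \<or> R2 n1 n2 ph \<le> ereal z \<or> 0 < ph \<and> R1 n1 n2 ph \<le> ereal z"
  shows "0 \<le> rad1 n1 n2 ph z \<and> greatest (differences n1 n2 ph z) (U1 n1 n2 ph z)"
  using assms R2_le_imp[of ph] R1_le_iff[of ph] by (intro greatest_U1) auto

lemma upper_U3_nonneg:
  assumes ph: "0 \<le> ph" "ph < p_square n1 n2" and z_less: "ereal z < R1 n1 n2 ph"
  shows "0 \<le> rad3 n1 n2 ph z \<and> greatest (differences n1 n2 ph z) (U3 n1 n2 ph z)"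
  using assms p_square_pos[OF n1 n2] R1_le_iff[of ph]
  by (intro greatest_U3) (auto simp: not_le[symmetric])

lemma upper_U3_nonpos:
  assumes ph: "- 1 \<le> ph" "ph \<le> 0" and z_less: "ereal z < R2 n1 n2 ph"
    and reach: "- p_square n1 n2 \<le> ph \<or> R1 n1 n2 ph \<le> ereal z"
  shows "0 \<le> rad3 n1 n2 ph z \<and> greatest (differences n1 n2 ph z) (U3 n1 n2 ph z)"
proof (rule greatest_U3)
  show "0 < interior_gap n1 n2 ph z (p_square n1 n2)"
    using R2_le_iff[of "- ph"] ph z_less
    by (simp add: R_reflect interior_gap_reflect not_le[symmetric])
  show "- p_square n1 n2 \<le> ph \<or> interior_gap n1 n2 ph z (- p_square n1 n2) \<le> 0"
    using R1_le_iff[of "- ph"] ph reach by (auto simp: R_reflect interior_gap_reflect)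
qed (use ph p_square_pos[OF n1 n2] in auto)

lemma lower_L1:
  assumes "p_square n1 n2 < ph" "ph \<le> 1" "ereal z \<le> R1 n1 n2 ph"
  shows "0 \<le> rad1 n1 n2 ph z \<and> smallest (differences n1 n2 ph z) (L1 n1 n2 ph z)"
  using assms p_square_pos[OF n1 n2] le_R1_imp[of ph] by (intro smallest_L1) auto

lemma lower_L2:
  assumes "- 1 \<le> ph" "ph \<le> 1"
    and "ph \<le> - p_square n1 n2 \<or> R2 n1 n2 ph \<le> ereal z \<or> ph < 0 \<and> R1 n1 n2 ph \<le> ereal z"
  shows "0 \<le> rad2 n1 n2 ph z \<and> smallest (differences n1 n2 ph z) (L2 n1 n2 ph z)"
  using assms upper_U1[of "- ph"]
  by (auto simp: smallest_reflect L2_eq_reflect rad2_eq_rad1_reflect R_reflect)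

lemma lower_L3_nonpos:
  assumes "- p_square n1 n2 < ph" "ph \<le> 0" "ereal z < R1 n1 n2 ph"
  shows "0 \<le> rad3 n1 n2 ph z \<and> smallest (differences n1 n2 ph z) (L3 n1 n2 ph z)"
  using assms upper_U3_nonneg[of "- ph"]
  by (auto simp: smallest_reflect L3_eq_reflect rad3_reflect R_reflect)

lemma lower_L3_nonneg:
  assumes "0 \<le> ph" "ph \<le> 1" "ereal z < R2 n1 n2 ph"
    and "ph \<le> p_square n1 n2 \<or> R1 n1 n2 ph \<le> ereal z"
  shows "0 \<le> rad3 n1 n2 ph z \<and> smallest (differences n1 n2 ph z) (L3 n1 n2 ph z)"
  using assms upper_U3_nonpos[of "- ph"]
  by (auto simp: smallest_reflect L3_eq_reflect rad3_reflect R_reflect)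

lemma upper_U2:
  assumes "- 1 \<le> ph" "ph < - p_square n1 n2" "ereal z \<le> R1 n1 n2 ph"
  shows "0 \<le> rad2 n1 n2 ph z \<and> greatest (differences n1 n2 ph z) (U2 n1 n2 ph z)"
  using assms lower_L1[of "- ph"]
  by (auto simp: greatest_reflect U2_eq_reflect rad2_eq_rad1_reflect R_reflect)

end

section \<open>The six regions\<close>

lemma smallest_unique: "smallest D l \<Longrightarrow> smallest D l' \<Longrightarrow> l = l'"
  and greatest_unique: "greatest D u \<Longrightarrow> greatest D u' \<Longrightarrow> u = u'"
  by (auto simp: smallest_def greatest_def intro: antisym)

lemma optimal_values_unique:
  "optimal_values n1 n2 ph z X \<Longrightarrow> optimal_values n1 n2 ph z Y \<Longrightarrow> X = Y"
  by (cases X; cases Y) (auto simp: optimal_values_iff intro: smallest_unique greatest_unique)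

context
  fixes n1 n2 :: real
  assumes n1: "n1 > 0" and n2: "n2 > 0"
begin

lemma R1_nonneg: "0 \<le> R1 n1 n2 ph"
  unfolding R1_def using n_min_pos[OF n1 n2] n_square_diff_nonneg[OF n1 n2]
  by (intro zero_le_divide_ereal) auto

lemma R1_eq_0:
  assumes "\<bar>ph\<bar> = p_square n1 n2"
  shows "R1 n1 n2 ph = 0"
proof -
  have "2 * n_max n1 n2 * \<bar>ph\<bar> - (n_max n1 n2 + n_min n1 n2) = 0"
    unfolding assms p_square_def using n_max_pos[OF n1 n2] by simp
  then show ?thesis unfolding R1_def by (simp add: divide_ereal_def zero_ereal_def[symmetric])
qed

lemma R1_pos:
  assumes "\<bar>ph\<bar> \<noteq> p_square n1 n2"
  shows "0 < R1 n1 n2 ph"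
proof -
  have "2 * n_max n1 n2 * \<bar>ph\<bar> - (n_max n1 n2 + n_min n1 n2) \<noteq> 0"
    using assms n_max_pos[OF n1 n2] by (simp add: p_square_def field_simps)
  then show ?thesis
    unfolding R1_def using n_min_pos[OF n1 n2] n_square_diff_nonneg[OF n1 n2]
    by (intro ereal_ratio_pos) auto
qed

text \<open>The second alternative occurs for equal sample sizes, where both thresholds can be
  infinite; \<open>R2 \<le> z\<close> is impossible then.\<close>
lemma R1_less_R2:
  assumes "ph \<noteq> 0"
  shows "R1 n1 n2 ph < R2 n1 n2 ph \<or> R2 n1 n2 ph = \<infinity>"
  unfolding R1_def R2_def
proof (rule ereal_ratio_mono)
  have "\<bar>2 * n_max n1 n2 * \<bar>ph\<bar> - (n_max n1 n2 + n_min n1 n2)\<bar>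
      < 2 * n_max n1 n2 * \<bar>ph\<bar> + (n_max n1 n2 + n_min n1 n2)"
    using assms n_max_pos[OF n1 n2] n_min_pos[OF n1 n2] by (auto simp: abs_less_iff)
  then show "sqrt (n_min n1 n2) * \<bar>2 * n_max n1 n2 * \<bar>ph\<bar> - (n_max n1 n2 + n_min n1 n2)\<bar>
    < sqrt (n_min n1 n2) * (2 * n_max n1 n2 * \<bar>ph\<bar> + (n_max n1 n2 + n_min n1 n2))"
    using n_min_pos[OF n1 n2] by simp
qed (use n_min_pos[OF n1 n2] n_square_diff_nonneg[OF n1 n2] in auto)

text \<open>For \<open>ph = 0\<close> the points \<open>\<plusminus>p_square\<close> are equally far away. The value 0 is missing from
  the fourth and fifth region, so this equality is what lets the second and sixth one cover
  it.\<close>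
lemma R1_eq_R2_at_0: "R1 n1 n2 0 = R2 n1 n2 0"
  using n_min_pos[OF n1 n2] n_max_pos[OF n1 n2] by (simp add: R1_def R2_def)

lemma R2_pos: "0 < R2 n1 n2 ph"
  unfolding R2_def using n_min_pos[OF n1 n2] n_max_pos[OF n1 n2] n_square_diff_nonneg[OF n1 n2]
  by (intro ereal_ratio_pos mult_pos_pos add_nonneg_pos) auto

lemma R1_le_R2: "R1 n1 n2 ph \<le> R2 n1 n2 ph"
  using R1_less_R2[of ph] R1_eq_R2_at_0 by (cases "ph = 0") auto

text \<open>Beyond the second region, the value of \<open>ph\<close> relative to 0 and \<open>\<plusminus>p_square\<close> leaves two
  candidates, separated by \<open>R1\<close>. At \<open>\<bar>ph\<bar> = p_square\<close> the threshold \<open>R1\<close> is 0, so that the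
  strict inequality \<open>R1 < z\<close> of the fourth and fifth region holds for every \<open>z\<close>.\<close>
lemma region_cover:
  assumes ph: "- 1 \<le> ph" "ph \<le> 1" and z: "0 < z"
  shows "\<exists>c. (ph, z) \<in> region n1 n2 c"
proof (cases "R2 n1 n2 ph \<le> ereal z")
  case True
  then have "(ph, z) \<in> region n1 n2 Case2" using ph by simp
  then show ?thesis by blast
next
  case False
  note lt = this
  let ?p = "p_square n1 n2"
  have p: "0 < ?p" using p_square_pos[OF n1 n2] .
  have "?p < \<bar>ph\<bar> \<or> \<bar>ph\<bar> = ?p \<or> \<bar>ph\<bar> < ?p \<and> ph \<noteq> 0 \<or> ph = 0" by linarith
  then consider "?p < ph" | "ph < - ?p" | "\<bar>ph\<bar> = ?p" | "0 < ph" "ph < ?p" | "- ?p < ph" "ph < 0" | "ph = 0"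
    by linarith
  then show ?thesis
  proof cases
    case 1
    then have "(ph, z) \<in> region n1 n2 Case1 \<or> (ph, z) \<in> region n1 n2 Case5" using lt ph z by auto
    then show ?thesis by blast
  next
    case 2
    then have "(ph, z) \<in> region n1 n2 Case3 \<or> (ph, z) \<in> region n1 n2 Case4" using lt ph z by auto
    then show ?thesis by blast
  next
    case 3
    then have "R1 n1 n2 ph < ereal z" using R1_eq_0 z by simp
    with 3 have "(ph, z) \<in> region n1 n2 Case5 \<or> (ph, z) \<in> region n1 n2 Case4" using lt ph z by auto
    then show ?thesis by blast
  next
    case 4
    then have "(ph, z) \<in> region n1 n2 Case5 \<or> (ph, z) \<in> region n1 n2 Case6" using lt ph z p by auto
    then show ?thesis by blast
  next
    case 5
    then have "(ph, z) \<in> region n1 n2 Case4 \<or> (ph, z) \<in> region n1 n2 Case6" using lt ph z p by auto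
    then show ?thesis by blast
  next
    case 6
    then have "(ph, z) \<in> region n1 n2 Case6" using lt p z R1_eq_R2_at_0 by auto
    then show ?thesis by blast
  qed
qed

lemma region_subset:
  assumes "(ph, z) \<in> region n1 n2 c"
  shows "- 1 \<le> ph \<and> ph \<le> 1 \<and> 0 < z"
proof -
  have p: "0 < p_square n1 n2" "p_square n1 n2 \<le> 1"
    using p_square_pos[OF n1 n2] p_square_le_1[OF n1 n2] .
  have z2: "0 < z" if "R2 n1 n2 ph \<le> ereal z"
    using R2_pos[of ph] that by (metis ereal_less(2) less_le_trans)
  have z1: "0 < z" if "R1 n1 n2 ph < ereal z"
    using R1_nonneg[of ph] that by (metis ereal_less(2) le_less_trans)
  have z3: "0 < z" if "R1 n1 n2 ph \<le> ereal z" "\<bar>ph\<bar> < p_square n1 n2"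
    using R1_pos[of ph] that by (metis ereal_less(2) less_le_trans less_irrefl)
  show ?thesis
    using assms p z1 z2 z3 by (cases c) auto
qed

text \<open>Only overlaps with the second region need an argument: there \<open>z\<close> is at least \<open>R2\<close>,
  hence at least \<open>R1\<close>, and even greater than \<open>R1\<close> if \<open>ph \<noteq> 0\<close>.\<close>
lemma region_disjoint: "disjoint_family (region n1 n2)"
proof -
  have p: "0 < p_square n1 n2" using p_square_pos[OF n1 n2] .
  have "c = c'" if "(ph, z) \<in> region n1 n2 c" "(ph, z) \<in> region n1 n2 c'" for ph z c c'
  proof -
    have "R2 n1 n2 ph \<le> ereal z \<Longrightarrow> R1 n1 n2 ph \<le> ereal z"
      using R1_le_R2[of ph] by (rule order_trans)
    moreover have "R2 n1 n2 ph \<le> ereal z \<Longrightarrow> ph \<noteq> 0 \<Longrightarrow> R1 n1 n2 ph < ereal z"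
      using R1_less_R2[of ph] by auto
    ultimately show ?thesis
      using that p by (cases c; cases c') auto
  qed
  then show ?thesis unfolding disjoint_family_on_def by fast
qed

lemma region_Case1:
  assumes "(ph, z) \<in> region n1 n2 Case1"
  shows "0 \<le> rad1 n1 n2 ph z \<and> optimal_values n1 n2 ph z (L1 n1 n2 ph z, U1 n1 n2 ph z)"
proof -
  interpret interval_data n1 n2 z
    using n1 n2 region_subset[OF assms] by unfold_locales auto
  show ?thesis
    using assms lower_L1[of ph] upper_U1[of ph] p_square_pos[OF n1 n2]
    by (auto simp: optimal_values_iff)
qed

lemma region_Case2:
  assumes "(ph, z) \<in> region n1 n2 Case2"
  shows "0 \<le> rad2 n1 n2 ph z \<and> 0 \<le> rad1 n1 n2 ph z
    \<and> optimal_values n1 n2 ph z (L2 n1 n2 ph z, U1 n1 n2 ph z)"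
proof -
  interpret interval_data n1 n2 z
    using n1 n2 region_subset[OF assms] by unfold_locales auto
  show ?thesis
    using assms lower_L2[of ph] upper_U1[of ph]
    by (auto simp: optimal_values_iff)
qed

lemma region_Case3:
  assumes "(ph, z) \<in> region n1 n2 Case3"
  shows "0 \<le> rad2 n1 n2 ph z \<and> optimal_values n1 n2 ph z (L2 n1 n2 ph z, U2 n1 n2 ph z)"
proof -
  interpret interval_data n1 n2 z
    using n1 n2 region_subset[OF assms] by unfold_locales auto
  show ?thesis
    using assms lower_L2[of ph] upper_U2[of ph] p_square_pos[OF n1 n2]
    by (auto simp: optimal_values_iff)
qed

lemma region_Case4:
  assumes "(ph, z) \<in> region n1 n2 Case4"
  shows "0 \<le> rad2 n1 n2 ph z \<and> 0 \<le> rad3 n1 n2 ph z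
    \<and> optimal_values n1 n2 ph z (L2 n1 n2 ph z, U3 n1 n2 ph z)"
proof -
  interpret interval_data n1 n2 z
    using n1 n2 region_subset[OF assms] by unfold_locales auto
  show ?thesis
    using assms lower_L2[of ph] upper_U3_nonpos[of ph] less_imp_le[of "R1 n1 n2 ph" "ereal z"]
      p_square_pos[OF n1 n2] p_square_le_1[OF n1 n2]
    by (auto simp: optimal_values_iff)
qed

lemma region_Case5:
  assumes "(ph, z) \<in> region n1 n2 Case5"
  shows "0 \<le> rad3 n1 n2 ph z \<and> 0 \<le> rad1 n1 n2 ph z
    \<and> optimal_values n1 n2 ph z (L3 n1 n2 ph z, U1 n1 n2 ph z)"
proof -
  interpret interval_data n1 n2 z
    using n1 n2 region_subset[OF assms] by unfold_locales auto
  show ?thesis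
    using assms lower_L3_nonneg[of ph] upper_U1[of ph] less_imp_le[of "R1 n1 n2 ph" "ereal z"]
      p_square_pos[OF n1 n2] p_square_le_1[OF n1 n2]
    by (auto simp: optimal_values_iff)
qed

lemma region_Case6:
  assumes "(ph, z) \<in> region n1 n2 Case6"
  shows "0 \<le> rad3 n1 n2 ph z \<and> optimal_values n1 n2 ph z (L3 n1 n2 ph z, U3 n1 n2 ph z)"
proof -
  interpret interval_data n1 n2 z
    using n1 n2 region_subset[OF assms] by unfold_locales auto
  show ?thesis
  proof (cases "0 \<le> ph")
    case True
    then show ?thesis
      using assms upper_U3_nonneg[of ph] lower_L3_nonneg[of ph] p_square_le_1[OF n1 n2] R1_le_R2[of ph]
      by (auto simp: optimal_values_iff)
  next
    case False
    then show ?thesis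
      using assms lower_L3_nonpos[of ph] upper_U3_nonpos[of ph] p_square_le_1[OF n1 n2] R1_le_R2[of ph]
      by (auto simp: optimal_values_iff)
  qed
qed

lemma optimal_values_exists:
  assumes "- 1 \<le> ph" "ph \<le> 1" "0 < z"
  shows "\<exists>LU. optimal_values n1 n2 ph z LU"
proof -
  obtain c where "(ph, z) \<in> region n1 n2 c"
    using region_cover[OF assms] by blast
  then show ?thesis
    using region_Case1[of ph] region_Case2[of ph] region_Case3[of ph]
      region_Case4[of ph] region_Case5[of ph] region_Case6[of ph]
    by (cases c) blast+
qed

end

theorem theorem1:
  fixes n1 n2 :: real
  assumes "n1 > 0" and "n2 > 0"
  shows
    "(\<forall>ph z. - 1 \<le> ph \<and> ph \<le> 1 \<and> 0 < z \<longrightarrow>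
        (\<exists>!LU. optimal_values n1 n2 ph z LU) \<and>
        (\<forall>L U. optimal_values n1 n2 ph z (L, U) \<longrightarrow>
          ((ph, z) \<in> region n1 n2 Case1 \<longrightarrow> (L, U) = (L1 n1 n2 ph z, U1 n1 n2 ph z)) \<and>
          ((ph, z) \<in> region n1 n2 Case2 \<longrightarrow> (L, U) = (L2 n1 n2 ph z, U1 n1 n2 ph z)) \<and>
          ((ph, z) \<in> region n1 n2 Case3 \<longrightarrow> (L, U) = (L2 n1 n2 ph z, U2 n1 n2 ph z)) \<and>
          ((ph, z) \<in> region n1 n2 Case4 \<longrightarrow> (L, U) = (L2 n1 n2 ph z, U3 n1 n2 ph z)) \<and>
          ((ph, z) \<in> region n1 n2 Case5 \<longrightarrow> (L, U) = (L3 n1 n2 ph z, U1 n1 n2 ph z)) \<and>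
          ((ph, z) \<in> region n1 n2 Case6 \<longrightarrow> (L, U) = (L3 n1 n2 ph z, U3 n1 n2 ph z)))) \<and>
     disjoint_family (region n1 n2) \<and>
     (\<Union>c. region n1 n2 c) = {(ph, z). ph \<in> {- 1..1} \<and> 0 < z} \<and>
     (\<forall>(ph, z) \<in> region n1 n2 Case1. 0 \<le> rad1 n1 n2 ph z) \<and>
     (\<forall>(ph, z) \<in> region n1 n2 Case2. 0 \<le> rad2 n1 n2 ph z \<and> 0 \<le> rad1 n1 n2 ph z) \<and>
     (\<forall>(ph, z) \<in> region n1 n2 Case3. 0 \<le> rad2 n1 n2 ph z) \<and>
     (\<forall>(ph, z) \<in> region n1 n2 Case4. 0 \<le> rad2 n1 n2 ph z \<and> 0 \<le> rad3 n1 n2 ph z) \<and>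
     (\<forall>(ph, z) \<in> region n1 n2 Case5. 0 \<le> rad3 n1 n2 ph z \<and> 0 \<le> rad1 n1 n2 ph z) \<and>
     (\<forall>(ph, z) \<in> region n1 n2 Case6. 0 \<le> rad3 n1 n2 ph z)"
proof -
  note cases = region_Case1[OF assms] region_Case2[OF assms] region_Case3[OF assms]
    region_Case4[OF assms] region_Case5[OF assms] region_Case6[OF assms]
  have optimal: "(\<exists>!LU. optimal_values n1 n2 ph z LU) \<and>
        (\<forall>L U. optimal_values n1 n2 ph z (L, U) \<longrightarrow>
          ((ph, z) \<in> region n1 n2 Case1 \<longrightarrow> (L, U) = (L1 n1 n2 ph z, U1 n1 n2 ph z)) \<and>
          ((ph, z) \<in> region n1 n2 Case2 \<longrightarrow> (L, U) = (L2 n1 n2 ph z, U1 n1 n2 ph z)) \<and>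
          ((ph, z) \<in> region n1 n2 Case3 \<longrightarrow> (L, U) = (L2 n1 n2 ph z, U2 n1 n2 ph z)) \<and>
          ((ph, z) \<in> region n1 n2 Case4 \<longrightarrow> (L, U) = (L2 n1 n2 ph z, U3 n1 n2 ph z)) \<and>
          ((ph, z) \<in> region n1 n2 Case5 \<longrightarrow> (L, U) = (L3 n1 n2 ph z, U1 n1 n2 ph z)) \<and>
          ((ph, z) \<in> region n1 n2 Case6 \<longrightarrow> (L, U) = (L3 n1 n2 ph z, U3 n1 n2 ph z)))"
    if dom: "- 1 \<le> ph \<and> ph \<le> 1 \<and> 0 < z" for ph z
  proof (rule conjI, goal_cases)
    case 1
    from dom obtain LU where LU: "optimal_values n1 n2 ph z LU"
      using optimal_values_exists[OF assms, of ph z] by auto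
    show ?case by (rule ex1I, rule LU, erule optimal_values_unique[OF _ LU])
  next
    case 2
    show ?case
      by (intro allI impI conjI; erule optimal_values_unique) (use cases in blast)+
  qed
  have cover: "(\<Union>c. region n1 n2 c) = {(ph, z). ph \<in> {- 1..1} \<and> 0 < z}"
  proof (rule set_eqI, clarify)
    fix ph z
    show "(ph, z) \<in> (\<Union>c. region n1 n2 c) \<longleftrightarrow> (ph, z) \<in> {(ph, z). ph \<in> {- 1..1} \<and> 0 < z}"
      using region_cover[OF assms, of ph z] region_subset[OF assms, of ph z]
      unfolding UN_iff mem_Collect_eq case_prod_conv atLeastAtMost_iff by blast
  qed
  have ball: "\<forall>(ph, z)\<in>S. P ph z" if "\<And>ph z. (ph, z) \<in> S \<Longrightarrow> P ph z"
    for S and P :: "real \<Rightarrow> real \<Rightarrow> bool"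
    using that by blast
  show ?thesis
    by (intro conjI ball region_disjoint[OF assms] cover)
       (intro allI impI, erule optimal, (use cases in blast)+)
qed

end
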